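(* Let $N$ and $K$ be positive integers, let $\mathbf{y} \in \mathbb{R}^N$, let $\lambda > 0$, and let $\phi$ be one of the three parameterized penalty functions $\phi_{\mathrm{log}}$, $\phi_{\mathrm{atan}}$, $\phi_{\mathrm{rat}}$ defined in the context. If $$0 < a < \frac{1}{K\lambda},$$ then the function $F : \mathbb{R}^N \to \mathbb{R}$ defined by $$F(\mathbf{x}) = \frac{1}{2} \|\mathbf{y} - \mathbf{x}\|_2^2 + \lambda \sum_{i\in\mathbb{Z}} \phi(\|\mathbf{x}_{i,K}\|_2; a)$$ is strictly convex.
   Context: Vectors in $\mathbb{R}^N$ are indexed as $\mathbf{x} = [x(0),\dots,x(N-1)]$. For $i \in \mathbb{Z}$, the $i$-th group of size $K$ is $\mathbf{x}_{i,K} = [x(i),\dots,x(i+K-1)] \in \mathbb{R}^K$, with the convention $x(j)=0$ for $j \notin \{0,\dots,N-1\}$. (Since $\phi(0;a)=0$ for each penalty below, only finitely many terms of the sum are nonzero.) For $a>0$ and $x\in\mathbb{R}$ the penalty functions are $$\phi_{\mathrm{log}}(x; a) = \frac{1}{a}\log(1 + a|x|),$$ $$\phi_{\mathrm{atan}}(x; a) = \frac{2}{a\sqrt{3}}\left(\tan^{-1}\left(\frac{1+2a|x|}{\sqrt{3}}\right) - \frac{\pi}{6}\right),$$ $$\phi_{\mathrm{rat}}(x; a) = \frac{|x|}{1 + a|x|/2}.$$ *)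

theory Defs
  imports
    "Jordan_Normal_Form.Matrix"
    "HOL-Analysis.L2_Norm"
    "HOL-Analysis.Infinite_Sum"
begin

definition phi_log :: "real \<Rightarrow> real \<Rightarrow> real" where
  "phi_log x a = (1 / a) * ln (1 + a * \<bar>x\<bar>)"

definition phi_atan :: "real \<Rightarrow> real \<Rightarrow> real" where
  "phi_atan x a = 2 / (a * sqrt 3) * (arctan ((1 + 2 * a * \<bar>x\<bar>) / sqrt 3) - pi / 6)"

definition phi_rat :: "real \<Rightarrow> real \<Rightarrow> real" where
  "phi_rat x a = \<bar>x\<bar> / (1 + a * \<bar>x\<bar> / 2)"

text \<open>The space \<open>\<real>\<^sup>N\<close> is \<^term>\<open>carrier_vec N\<close>, whose vectors are indexed by \<open>0, \<dots>, N - 1\<close>.\<close>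

definition l2_norm :: "real vec \<Rightarrow> real" where
  "l2_norm v = L2_set (vec_index v) {..<dim_vec v}"

definition zero_ext :: "real vec \<Rightarrow> int \<Rightarrow> real" where
  "zero_ext x j = (if 0 \<le> j \<and> j < int (dim_vec x) then vec_index x (nat j) else 0)"

definition group_vec :: "real vec \<Rightarrow> int \<Rightarrow> nat \<Rightarrow> real vec" where
  "group_vec x i K = vec K (\<lambda>k. zero_ext x (i + int k))"

definition strictly_convex_on_carrier :: "nat \<Rightarrow> (real vec \<Rightarrow> real) \<Rightarrow> bool" where
  "strictly_convex_on_carrier n F \<longleftrightarrow>
    (\<forall>u \<in> carrier_vec n. \<forall>v \<in> carrier_vec n. \<forall>t. u \<noteq> v \<longrightarrow> 0 < t \<longrightarrow> t < 1 \<longrightarrow>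
      F ((1 - t) \<cdot>\<^sub>v u + t \<cdot>\<^sub>v v) < (1 - t) * F u + t * F v)"

text \<open>All but finitely many groups are zero vectors and the penalties vanish at 0, so the sum over
  all integers below is the sum of a finitely supported family.\<close>

definition ogs_objective ::
    "(real \<Rightarrow> real \<Rightarrow> real) \<Rightarrow> real \<Rightarrow> nat \<Rightarrow> real \<Rightarrow> real vec \<Rightarrow> real vec \<Rightarrow> real" where
  "ogs_objective \<phi> a K lam y x =
    1 / 2 * (l2_norm (y - x))\<^sup>2 + lam * (\<Sum>\<^sub>\<infinity>i\<in>(UNIV :: int set). \<phi> (l2_norm (group_vec x i K)) a)"

end

theory Submission
  imports Defs "HOL-Analysis.Convex"
begin

text \<open>The derivative of each penalty on \<open>r \<ge> 0\<close> is \<open>1 / p (a * r)\<close>, where \<open>p u\<close> is \<open>1 + u\<close>,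
  \<open>1 + u + u\<^sup>2\<close> or \<open>(1 + u / 2)\<^sup>2\<close>, and \<open>1 / p u + u\<close> is positive and nondecreasing. So
  \<open>\<phi> r + a / 2 * r\<^sup>2\<close> is convex and nondecreasing on \<open>r \<ge> 0\<close>, and composing it with a norm gives a
  convex function. Hence the penalty of a group loses at most
  \<open>a / 2 * t * (1 - t) * \<parallel>u\<^sub>i - v\<^sub>i\<parallel>\<^sup>2\<close> of convexity between \<open>u\<close> and \<open>v\<close>. Every entry lies in exactly
  \<open>K\<close> groups, so the total loss is at most \<open>lam * K * a / 2 * t * (1 - t) * \<parallel>u - v\<parallel>\<^sup>2\<close>, which is less
  than the gain \<open>1 / 2 * t * (1 - t) * \<parallel>u - v\<parallel>\<^sup>2\<close> of the quadratic term.\<close>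

section \<open>Weak convexity of a scalar penalty composed with a Euclidean norm\<close>

lemma L2_set_power2: "(L2_set f A)\<^sup>2 = (\<Sum>i\<in>A. (f i)\<^sup>2)"
  by (simp add: L2_set_def sum_nonneg)

lemma L2_set_convex_combination:
  fixes t :: real
  shows "(L2_set (\<lambda>k. (1 - t) * f k + t * g k) A)\<^sup>2 =
    (1 - t) * (L2_set f A)\<^sup>2 + t * (L2_set g A)\<^sup>2 - t * (1 - t) * (L2_set (\<lambda>k. f k - g k) A)\<^sup>2"
  unfolding L2_set_power2 sum_distrib_left sum.distrib[symmetric] sum_subtractf[symmetric]
  by (intro sum.cong refl) (simp add: power2_eq_square algebra_simps)

lemma weakly_convex_L2_set:
  fixes \<phi> :: "real \<Rightarrow> real"
  assumes convex: "convex_on {0..} (\<lambda>r. \<phi> r + a / 2 * r\<^sup>2)"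
    and mono: "mono_on {0..} (\<lambda>r. \<phi> r + a / 2 * r\<^sup>2)"
    and t: "0 \<le> t" "t \<le> 1"
  shows "\<phi> (L2_set (\<lambda>k. (1 - t) * f k + t * g k) A) \<le>
    (1 - t) * \<phi> (L2_set f A) + t * \<phi> (L2_set g A) + a / 2 * (t * (1 - t) * (L2_set (\<lambda>k. f k - g k) A)\<^sup>2)"
proof -
  define \<psi> where "\<psi> r = \<phi> r + a / 2 * r\<^sup>2" for r
  let ?w = "L2_set (\<lambda>k. (1 - t) * f k + t * g k) A"
  have "?w \<le> L2_set (\<lambda>k. (1 - t) * f k) A + L2_set (\<lambda>k. t * g k) A"
    by (rule L2_set_triangle_ineq)
  also have "\<dots> = (1 - t) * L2_set f A + t * L2_set g A"
    using t by (simp add: L2_set_right_distrib)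
  \<comment> \<open>The triangle inequality bounds \<open>?w\<close> only from above, so
    monotonicity of \<open>\<psi>\<close> must come before its convexity.\<close>
  finally have "\<psi> ?w \<le> \<psi> ((1 - t) * L2_set f A + t * L2_set g A)"
    using t by (intro mono_onD[OF mono[folded \<psi>_def]]) auto
  also have "\<dots> \<le> (1 - t) * \<psi> (L2_set f A) + t * \<psi> (L2_set g A)"
    using convex_onD[OF convex[folded \<psi>_def], of t "L2_set f A" "L2_set g A"] t by simp
  \<comment> \<open>Removing the quadratic part of \<open>\<psi>\<close> from both sides leaves
    exactly the convexity defect of the squared norm.\<close>
  finally show ?thesis
    unfolding \<psi>_def L2_set_convex_combination
    by (simp add: algebra_simps add_divide_distrib diff_divide_distrib)
qed

text \<open>\<open>slope\<close> is the monotonicity of \<open>1 / p u + u\<close> with denominators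
  cleared. The function \<open>g\<close> is the penalty formula without absolute values, so it is
  differentiable at 0, where \<open>\<phi>\<close> itself may have a kink.\<close>

lemma weakly_convex_of_deriv:
  fixes \<phi> :: "real \<Rightarrow> real"
  assumes "0 < a"
    and eq: "\<And>r. 0 \<le> r \<Longrightarrow> \<phi> r = g r"
    and deriv: "\<And>r. 0 \<le> r \<Longrightarrow> (g has_real_derivative 1 / p (a * r)) (at r)"
    and pos: "\<And>u. 0 \<le> u \<Longrightarrow> 0 < p u"
    and slope: "\<And>u w. 0 \<le> u \<Longrightarrow> u \<le> w \<Longrightarrow> p w - p u \<le> (w - u) * (p u * p w)"
  shows "convex_on {0..} (\<lambda>r. \<phi> r + a / 2 * r\<^sup>2)" "mono_on {0..} (\<lambda>r. \<phi> r + a / 2 * r\<^sup>2)"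
proof -
  have d: "((\<lambda>r. g r + a / 2 * r\<^sup>2) has_real_derivative 1 / p (a * r) + a * r) (at r)"
    if "0 \<le> r" for r
    by (rule derivative_eq_intros deriv[OF that] refl)+ (simp add: field_simps)
  have "convex_on {0..} (\<lambda>r. g r + a / 2 * r\<^sup>2)"
  proof (rule convex_on_realI)
    fix r s :: real
    assume "r \<in> {0..}" "s \<in> {0..}" "r \<le> s"
    then have "0 \<le> a * r" "a * r \<le> a * s" using \<open>0 < a\<close> by auto
    with pos[of "a * r"] pos[of "a * s"] slope[of "a * r" "a * s"]
    show "1 / p (a * r) + a * r \<le> 1 / p (a * s) + a * s"
      by (simp add: field_simps)
  qed (use d in auto)
  then show "convex_on {0..} (\<lambda>r. \<phi> r + a / 2 * r\<^sup>2)"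
    unfolding convex_on_def using eq by simp
  show "mono_on {0..} (\<lambda>r. \<phi> r + a / 2 * r\<^sup>2)"
  proof (rule mono_onI)
    fix r s :: real
    assume rs: "r \<in> {0..}" "s \<in> {0..}" "r \<le> s"
    have "g r + a / 2 * r\<^sup>2 \<le> g s + a / 2 * s\<^sup>2"
    proof (rule DERIV_nonneg_imp_nondecreasing[OF \<open>r \<le> s\<close>])
      fix x assume "r \<le> x" "x \<le> s"
      with rs \<open>0 < a\<close> have "0 \<le> x" "0 \<le> a * x" by auto
      then show "\<exists>y. ((\<lambda>r. g r + a / 2 * r\<^sup>2) has_real_derivative y) (at x) \<and> 0 \<le> y"
        using d[of x] pos[of "a * x"] by (intro exI[of _ "1 / p (a * x) + a * x"]) simp
    qed
    with rs eq show "\<phi> r + a / 2 * r\<^sup>2 \<le> \<phi> s + a / 2 * s\<^sup>2" by simp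
  qed
qed

section \<open>The logarithmic, arctangent and rational penalties\<close>

lemma phi_log_weakly_convex:
  assumes "0 < a"
  shows "convex_on {0..} (\<lambda>r. phi_log r a + a / 2 * r\<^sup>2)"
    "mono_on {0..} (\<lambda>r. phi_log r a + a / 2 * r\<^sup>2)"
proof -
  have deriv: "((\<lambda>r. 1 / a * ln (1 + a * r)) has_real_derivative 1 / (1 + a * r)) (at r)"
    if "0 \<le> r" for r
  proof -
    have "0 < 1 + a * r" using assms that by (simp add: add_pos_nonneg)
    then have "((\<lambda>r. 1 / a * ln (1 + a * r)) has_real_derivative 1 / a * (a / (1 + a * r))) (at r)"
      by (auto intro!: derivative_eq_intros)
    then show ?thesis using assms by simp
  qed
  have slope: "(1 + w) - (1 + u) \<le> (w - u) * ((1 + u) * (1 + w))" if "0 \<le> u" "u \<le> w" for u w :: real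
  proof -
    \<comment> \<open>Here \<open>p w - p u = w - u\<close>, so it suffices that
      \<open>p u * p w\<close> is at least 1.\<close>
    have "1 \<le> (1 + u) * (1 + w)" using that by (simp add: algebra_simps)
    then show ?thesis using that mult_left_mono[of 1 "(1 + u) * (1 + w)" "w - u"] by simp
  qed
  show "convex_on {0..} (\<lambda>r. phi_log r a + a / 2 * r\<^sup>2)"
    by (rule weakly_convex_of_deriv(1)[OF assms, where p = "\<lambda>u. 1 + u"])
      (use deriv slope in \<open>auto simp: phi_log_def\<close>)
  show "mono_on {0..} (\<lambda>r. phi_log r a + a / 2 * r\<^sup>2)"
    by (rule weakly_convex_of_deriv(2)[OF assms, where p = "\<lambda>u. 1 + u"])
      (use deriv slope in \<open>auto simp: phi_log_def\<close>)
qed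

lemma phi_atan_weakly_convex:
  assumes "0 < a"
  shows "convex_on {0..} (\<lambda>r. phi_atan r a + a / 2 * r\<^sup>2)"
    "mono_on {0..} (\<lambda>r. phi_atan r a + a / 2 * r\<^sup>2)"
proof -
  have deriv: "((\<lambda>r. 2 / (a * sqrt 3) * (arctan ((1 + 2 * a * r) / sqrt 3) - pi / 6))
      has_real_derivative 1 / (1 + a * r + (a * r)\<^sup>2)) (at r)" if "0 \<le> r" for r
  proof -
    have "0 < 1 + a * r + (a * r)\<^sup>2" using assms that by (simp add: add_pos_nonneg)
    \<comment> \<open>Completing the square. The factor 4/3 cancels against the prefactor
      \<open>2 / (a * sqrt 3)\<close> times the inner derivative
      \<open>2 * a / sqrt 3\<close>.\<close>
    moreover have "1 + ((1 + 2 * a * r) / sqrt 3)\<^sup>2 = 4 / 3 * (1 + a * r + (a * r)\<^sup>2)"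
      by (simp add: power2_eq_square field_simps)
    ultimately show ?thesis
      using assms
      by (auto intro!: derivative_eq_intros simp: inverse_eq_divide)
        (simp add: field_simps)
  qed
  have slope: "(1 + w + w\<^sup>2) - (1 + u + u\<^sup>2) \<le> (w - u) * ((1 + u + u\<^sup>2) * (1 + w + w\<^sup>2))"
    if "0 \<le> u" "u \<le> w" for u w :: real
  proof -
    \<comment> \<open>Since \<open>p w - p u = (w - u) * (1 + u + w)\<close>, the product need only
      dominate \<open>1 + u + w\<close>; its other monomials are nonnegative.\<close>
    have "(1 + u + u\<^sup>2) * (1 + w + w\<^sup>2) = 1 + u + w + (u\<^sup>2 + w\<^sup>2 + u * w + u * w\<^sup>2 + u\<^sup>2 * w + u\<^sup>2 * w\<^sup>2)"
      by (simp add: algebra_simps)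
    then have "1 + u + w \<le> (1 + u + u\<^sup>2) * (1 + w + w\<^sup>2)"
      using that by simp
    from mult_left_mono[OF this, of "w - u"] that show ?thesis
      by (simp add: algebra_simps power2_eq_square)
  qed
  have pos: "0 < 1 + u + u\<^sup>2" if "0 \<le> u" for u :: real
    using that by (simp add: add_pos_nonneg)
  show "convex_on {0..} (\<lambda>r. phi_atan r a + a / 2 * r\<^sup>2)"
    by (rule weakly_convex_of_deriv(1)[OF assms _ deriv pos slope]) (simp_all add: phi_atan_def)
  show "mono_on {0..} (\<lambda>r. phi_atan r a + a / 2 * r\<^sup>2)"
    by (rule weakly_convex_of_deriv(2)[OF assms _ deriv pos slope]) (simp_all add: phi_atan_def)
qed

lemma phi_rat_weakly_convex:
  assumes "0 < a"
  shows "convex_on {0..} (\<lambda>r. phi_rat r a + a / 2 * r\<^sup>2)"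
    "mono_on {0..} (\<lambda>r. phi_rat r a + a / 2 * r\<^sup>2)"
proof -
  have deriv: "((\<lambda>r. r / (1 + a * r / 2)) has_real_derivative 1 / (1 + a * r / 2)\<^sup>2) (at r)"
    if "0 \<le> r" for r
  proof -
    have "0 < 1 + a * r / 2" using assms that by (simp add: add_pos_nonneg)
    then show ?thesis
      by (auto intro!: derivative_eq_intros simp: power2_eq_square)
  qed
  have slope: "(1 + w / 2)\<^sup>2 - (1 + u / 2)\<^sup>2 \<le> (w - u) * ((1 + u / 2)\<^sup>2 * (1 + w / 2)\<^sup>2)"
    if "0 \<le> u" "u \<le> w" for u w :: real
  proof -
    \<comment> \<open>The left side is the quotient \<open>(p w - p u) / (w - u)\<close> when
      \<open>u \<noteq> w\<close>.\<close>
    have "1 + (u + w) / 4 \<le> (1 + u / 2) * (1 + w / 2)"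
      using that by (simp add: field_simps)
    \<comment> \<open>The product is at least 1, so squaring does not decrease it.\<close>
    also have "\<dots> \<le> ((1 + u / 2) * (1 + w / 2))\<^sup>2"
      by (rule self_le_power) (use that in \<open>auto simp: field_simps\<close>)
    finally have "1 + (u + w) / 4 \<le> (1 + u / 2)\<^sup>2 * (1 + w / 2)\<^sup>2"
      by (simp add: power_mult_distrib)
    from mult_left_mono[OF this, of "w - u"] that show ?thesis
      by (simp add: field_simps power2_eq_square)
  qed
  have pos: "0 < (1 + u / 2)\<^sup>2" if "0 \<le> u" for u :: real
    using that by simp
  show "convex_on {0..} (\<lambda>r. phi_rat r a + a / 2 * r\<^sup>2)"
    by (rule weakly_convex_of_deriv(1)[OF assms _ deriv pos slope]) (simp_all add: phi_rat_def)
  show "mono_on {0..} (\<lambda>r. phi_rat r a + a / 2 * r\<^sup>2)"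
    by (rule weakly_convex_of_deriv(2)[OF assms _ deriv pos slope]) (simp_all add: phi_rat_def)
qed

lemma phi_atan_0: "phi_atan 0 a = 0"
proof -
  have "arctan (1 / sqrt 3) = pi / 6"
    using arctan_tan[of "pi / 6"] pi_gt_zero by (simp add: tan_30)
  then show ?thesis by (simp add: phi_atan_def)
qed

section \<open>Sums over the overlapping groups\<close>

lemma l2_norm_group_vec:
  "l2_norm (group_vec x i K) = L2_set (\<lambda>k. zero_ext x (i + int k)) {..<K}"
  unfolding l2_norm_def group_vec_def by (auto intro: L2_set_cong)

text \<open>A group can meet the indices below \<open>N\<close> only if \<open>- int K < i\<close>
  and \<open>i < int N\<close>; elsewhere it is the zero vector. The interval depends on
  \<open>N\<close> and \<open>K\<close> alone, so it serves all vectors of the same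
  dimension.\<close>

lemma infsum_penalty:
  assumes "\<phi> 0 = 0" and "dim_vec x = N"
  shows "(\<Sum>\<^sub>\<infinity>i\<in>UNIV. \<phi> (l2_norm (group_vec x i K))) =
    (\<Sum>i\<in>{- int K..int N}. \<phi> (l2_norm (group_vec x i K)))"
proof -
  have "\<phi> (l2_norm (group_vec x i K)) = 0" if "i \<notin> {- int K..int N}" for i
  proof -
    have "L2_set (\<lambda>k. zero_ext x (i + int k)) {..<K} = L2_set (\<lambda>_. 0) {..<K}"
      using that assms(2) by (intro L2_set_cong) (auto simp: zero_ext_def)
    then show ?thesis using assms(1) by (simp add: l2_norm_group_vec L2_set_def)
  qed
  then have "(\<Sum>\<^sub>\<infinity>i\<in>UNIV. \<phi> (l2_norm (group_vec x i K))) =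
      (\<Sum>\<^sub>\<infinity>i\<in>{- int K..int N}. \<phi> (l2_norm (group_vec x i K)))"
    by (intro infsum_cong_neutral) auto
  then show ?thesis by simp
qed

text \<open>After exchanging the sums, each offset \<open>k < K\<close> contributes one full squared
  norm: the index \<open>i = int j - int k\<close> reads entry \<open>j\<close>, and it stays in the
  interval for every \<open>j < N\<close>.\<close>

lemma sum_l2_norm_group_vec:
  assumes "dim_vec x = N"
  shows "(\<Sum>i\<in>{- int K..int N}. (l2_norm (group_vec x i K))\<^sup>2) = real K * (l2_norm x)\<^sup>2"
proof -
  have shift: "(\<Sum>i\<in>{- int K..int N}. (zero_ext x (i + int k))\<^sup>2) = (l2_norm x)\<^sup>2" if "k < K" for k
  proof -
    have "(\<Sum>i\<in>{- int K..int N}. (zero_ext x (i + int k))\<^sup>2) =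
        (\<Sum>i\<in>(\<lambda>j. int j - int k) ` {..<N}. (zero_ext x (i + int k))\<^sup>2)"
    proof (rule sum.mono_neutral_right)
      show "\<forall>i\<in>{- int K..int N} - (\<lambda>j. int j - int k) ` {..<N}. (zero_ext x (i + int k))\<^sup>2 = 0"
      proof
        fix i assume i: "i \<in> {- int K..int N} - (\<lambda>j. int j - int k) ` {..<N}"
        have "\<not> (0 \<le> i + int k \<and> i + int k < int N)"
        proof
          assume "0 \<le> i + int k \<and> i + int k < int N"
          then have "i = int (nat (i + int k)) - int k" "nat (i + int k) < N" by auto
          then show False using i by blast
        qed
        then show "(zero_ext x (i + int k))\<^sup>2 = 0" using assms by (auto simp: zero_ext_def)
      qed
    qed (use that in auto)
    also have "\<dots> = (\<Sum>j<N. (zero_ext x (int j))\<^sup>2)"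
      by (subst sum.reindex) (auto simp: inj_on_def)
    also have "\<dots> = (l2_norm x)\<^sup>2"
      using assms by (simp add: l2_norm_def L2_set_power2 zero_ext_def)
    finally show ?thesis .
  qed
  have "(\<Sum>i\<in>{- int K..int N}. (l2_norm (group_vec x i K))\<^sup>2) =
      (\<Sum>k<K. \<Sum>i\<in>{- int K..int N}. (zero_ext x (i + int k))\<^sup>2)"
    unfolding l2_norm_group_vec L2_set_power2 by (rule sum.swap)
  then show ?thesis by (simp add: shift)
qed

section \<open>Convex combinations in the groups and in the quadratic term\<close>

lemma zero_ext_convex_combination:
  assumes "dim_vec u = dim_vec v"
  shows "zero_ext ((1 - t) \<cdot>\<^sub>v u + t \<cdot>\<^sub>v v) j = (1 - t) * zero_ext u j + t * zero_ext v j"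
  using assms by (simp add: zero_ext_def nat_less_iff)

lemma zero_ext_diff:
  assumes "dim_vec u = dim_vec v"
  shows "zero_ext (u - v) j = zero_ext u j - zero_ext v j"
  using assms by (simp add: zero_ext_def nat_less_iff)

text \<open>The residual at the combination is the same combination of the residuals at
  \<open>u\<close> and \<open>v\<close>, and \<open>y\<close> cancels in their difference.\<close>

lemma l2_norm_diff_convex_combination:
  assumes "y \<in> carrier_vec N" "u \<in> carrier_vec N" "v \<in> carrier_vec N"
  shows "(l2_norm (y - ((1 - t) \<cdot>\<^sub>v u + t \<cdot>\<^sub>v v)))\<^sup>2 =
    (1 - t) * (l2_norm (y - u))\<^sup>2 + t * (l2_norm (y - v))\<^sup>2 - t * (1 - t) * (l2_norm (u - v))\<^sup>2"
proof -
  have [simp]: "dim_vec y = N" "dim_vec u = N" "dim_vec v = N" using assms by auto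
  show ?thesis
    unfolding l2_norm_def L2_set_power2 sum_distrib_left
    by (simp add: sum.distrib[symmetric] sum_subtractf[symmetric])
      (intro sum.cong refl, simp add: power2_eq_square algebra_simps)
qed

lemma l2_norm_diff_pos:
  assumes "u \<in> carrier_vec N" "v \<in> carrier_vec N" "u \<noteq> v"
  shows "0 < l2_norm (u - v)"
proof -
  have "l2_norm (u - v) \<noteq> 0"
    using assms by (auto simp: l2_norm_def L2_set_eq_0_iff)
  then show ?thesis by (simp add: l2_norm_def order_less_le)
qed

section \<open>Balance of convexity gain and loss\<close>

lemma ogs_objective_strictly_convex:
  assumes y: "y \<in> carrier_vec N"
    and lam: "0 < lam" and small: "real K * lam * a < 1"
    and zero: "\<phi> 0 a = 0"
    and convex: "convex_on {0..} (\<lambda>r. \<phi> r a + a / 2 * r\<^sup>2)"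
    and mono: "mono_on {0..} (\<lambda>r. \<phi> r a + a / 2 * r\<^sup>2)"
  shows "strictly_convex_on_carrier N (ogs_objective \<phi> a K lam y)"
  unfolding strictly_convex_on_carrier_def
proof (intro ballI allI impI)
  fix u v :: "real Matrix.vec" and t :: real
  assume u: "u \<in> carrier_vec N" and v: "v \<in> carrier_vec N" and "u \<noteq> v" and t: "0 < t" "t < 1"
  define w where "w = (1 - t) \<cdot>\<^sub>v u + t \<cdot>\<^sub>v v"
  define I where "I = {- int K..int N}"
  define P where "P x = (\<Sum>i\<in>I. \<phi> (l2_norm (group_vec x i K)) a)" for x
  \<comment> \<open>The quadratic term gains \<open>D / 2\<close>; the penalties lose at most
    \<open>real K * lam * a * D / 2\<close>.\<close>
  define D where "D = t * (1 - t) * (l2_norm (u - v))\<^sup>2"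
  have [simp]: "dim_vec u = N" "dim_vec v = N" "dim_vec w = N"
    using u v by (auto simp: w_def)
  have F: "ogs_objective \<phi> a K lam y x = 1 / 2 * (l2_norm (y - x))\<^sup>2 + lam * P x"
    if "dim_vec x = N" for x
    using infsum_penalty[of "\<lambda>r. \<phi> r a", OF zero that] by (simp add: ogs_objective_def P_def I_def)
  have "\<phi> (l2_norm (group_vec w i K)) a \<le>
      (1 - t) * \<phi> (l2_norm (group_vec u i K)) a + t * \<phi> (l2_norm (group_vec v i K)) a +
      a / 2 * (t * (1 - t) * (l2_norm (group_vec (u - v) i K))\<^sup>2)" for i
    using weakly_convex_L2_set[OF convex mono, of t "\<lambda>k. zero_ext u (i + int k)"
        "\<lambda>k. zero_ext v (i + int k)" "{..<K}"] t
    by (simp add: l2_norm_group_vec w_def zero_ext_convex_combination zero_ext_diff)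
  then have "P w \<le> (\<Sum>i\<in>I. (1 - t) * \<phi> (l2_norm (group_vec u i K)) a +
      t * \<phi> (l2_norm (group_vec v i K)) a +
      a / 2 * (t * (1 - t) * (l2_norm (group_vec (u - v) i K))\<^sup>2))"
    unfolding P_def by (intro sum_mono)
  also have "\<dots> = (1 - t) * P u + t * P v +
      a / 2 * (t * (1 - t) * (\<Sum>i\<in>I. (l2_norm (group_vec (u - v) i K))\<^sup>2))"
    by (simp add: P_def sum.distrib sum_distrib_left)
  also have "(\<Sum>i\<in>I. (l2_norm (group_vec (u - v) i K))\<^sup>2) = real K * (l2_norm (u - v))\<^sup>2"
    unfolding I_def by (rule sum_l2_norm_group_vec) simp
  finally have "P w \<le> (1 - t) * P u + t * P v + a / 2 * real K * D"
    by (simp add: D_def mult_ac)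
  then have "lam * P w \<le> lam * ((1 - t) * P u + t * P v + a / 2 * real K * D)"
    using lam by (intro mult_left_mono) auto
  \<comment> \<open>Strictness enters here: \<open>D\<close> is positive because
    \<open>u \<noteq> v\<close> and \<open>t\<close> lies strictly between 0 and 1.\<close>
  moreover have "real K * lam * a * D < 1 * D"
    using small t l2_norm_diff_pos[OF u v \<open>u \<noteq> v\<close>]
    by (intro mult_strict_right_mono) (auto simp: D_def)
  moreover have "(l2_norm (y - w))\<^sup>2 = (1 - t) * (l2_norm (y - u))\<^sup>2 + t * (l2_norm (y - v))\<^sup>2 - D"
    unfolding w_def D_def by (rule l2_norm_diff_convex_combination[OF y u v])
  ultimately have "ogs_objective \<phi> a K lam y w <
      (1 - t) * ogs_objective \<phi> a K lam y u + t * ogs_objective \<phi> a K lam y v"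
    by (simp add: F) (simp add: algebra_simps add_divide_distrib diff_divide_distrib)
  then show "ogs_objective \<phi> a K lam y ((1 - t) \<cdot>\<^sub>v u + t \<cdot>\<^sub>v v) <
      (1 - t) * ogs_objective \<phi> a K lam y u + t * ogs_objective \<phi> a K lam y v"
    by (simp add: w_def)
qed

theorem corollary2:
  fixes N K :: nat
    and y :: "real Matrix.vec"
    and lam a :: real
    and \<phi> :: "real \<Rightarrow> real \<Rightarrow> real"
  assumes "N > 0" and "K > 0"
    and "y \<in> carrier_vec N"
    and "lam > 0"
    and "\<phi> \<in> {phi_log, phi_atan, phi_rat}"
    and "0 < a" and "a < 1 / (real K * lam)"
  shows "strictly_convex_on_carrier N (ogs_objective \<phi> a K lam y)"
proof (rule ogs_objective_strictly_convex[OF assms(3,4)])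
  show "real K * lam * a < 1"
    using assms(2,4,7) by (simp add: field_simps)
  show "\<phi> 0 a = 0"
    using assms(5) by (auto simp: phi_log_def phi_atan_0 phi_rat_def)
  show "convex_on {0..} (\<lambda>r. \<phi> r a + a / 2 * r\<^sup>2)" "mono_on {0..} (\<lambda>r. \<phi> r a + a / 2 * r\<^sup>2)"
    using assms(5) phi_log_weakly_convex[OF assms(6)] phi_atan_weakly_convex[OF assms(6)]
      phi_rat_weakly_convex[OF assms(6)] by auto
qed

end
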